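(* Let $(X,\rho)$ be a compact metric space, let $d\ge 1$, let $T:\mathbb{Z}^d\times X\to X$ be a continuous $\mathbb{Z}^d$-action on $X$, and let $k\in\{1,\dots,2^d\}$. Then $(X,T)$ is $k$-type mixing if and only if the induced action $(Sub_X,\hat{T})$ on the hyperspace $Sub_X$ is $k$-type mixing.
   Context: A $\mathbb{Z}^d$-action on $X$ is a continuous map $T:\mathbb{Z}^d\times X\to X$, written $T^n(x)=T(n,x)$, with $T^0(x)=x$ and $T^{n+m}(x)=T^n(T^m(x))$ for all $x\in X$, $n,m\in\mathbb{Z}^d$. For $k\in\{1,\dots,2^d\}$ let $k^b=(k^b_1,\dots,k^b_d)\in\{0,1\}^d$ be defined by $k-1=\sum_{i=1}^d k^b_i 2^{i-1}$. For $x,y\in\mathbb{Z}^d$, write $x\ge^k y$ if $(-1)^{k^b_i}x_i\ge(-1)^{k^b_i}y_i$ for all $i=1,\dots,d$. The hyperspace $Sub_X$ is the set of all non-empty closed (equivalently, non-empty compact) subsets of $X$, endowed with the Hausdorff metric $H(A,B)=\max\{\sup_{a\in A}\rho(a,B),\sup_{b\in B}\rho(b,A)\}$, where $\rho(x,S)=\inf_{s\in S}\rho(x,s)$; it is a compact metric space. The induced $\mathbb{Z}^d$-action $\hat{T}$ on $Sub_X$ is $\hat{T}^m(A)=T^m(A)=\{T^m(x):x\in A\}$. A $\mathbb{Z}^d$-action $T$ on a space $X$ is $k$-type mixing if for any non-empty open sets $U,V\subseteq X$ there is a finite set $F\subset\{n\in\mathbb{Z}^d:n\ge^k 0\}$ such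 that $T^m(U)\cap V\neq\emptyset$ for all $m\ge^k 0$ with $m\notin F$. The same definition applies to $(Sub_X,\hat{T})$. *)

theory Defs
  imports "HOL-Analysis.Analysis"
begin

text \<open>Vectors of \<open>\<int>\<^sup>d\<close> are functions on \<open>nat\<close> with coordinates \<open>1, \<dots>, d\<close>, set to zero
  elsewhere, so that equality of functions is equality of vectors.\<close>

definition zd :: "nat \<Rightarrow> (nat \<Rightarrow> int) set" where
  "zd d = {n. \<forall>i. i \<notin> {1..d} \<longrightarrow> n i = 0}"

definition zd_action :: "nat \<Rightarrow> 'a topology \<Rightarrow> ((nat \<Rightarrow> int) \<Rightarrow> 'a \<Rightarrow> 'a) \<Rightarrow> bool" where
  "zd_action d X T \<longleftrightarrow>
     continuous_map (prod_topology (discrete_topology (zd d)) X) X (\<lambda>(n, x). T n x) \<and>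
     (\<forall>x\<in>topspace X. T (\<lambda>i. 0) x = x) \<and>
     (\<forall>n\<in>zd d. \<forall>m\<in>zd d. \<forall>x\<in>topspace X. T (\<lambda>i. n i + m i) x = T n (T m x))"

definition kbits :: "nat \<Rightarrow> nat \<Rightarrow> nat \<Rightarrow> nat" where
  "kbits d k = (THE b. b \<in> {1..d} \<rightarrow>\<^sub>E {0, 1} \<and> k - 1 = (\<Sum>i=1..d. b i * 2 ^ (i - 1)))"

lemma kbits_ex1:
  assumes "k \<in> {1..2 ^ d}"
  shows "\<exists>!b::nat \<Rightarrow> nat. b \<in> {1..d} \<rightarrow>\<^sub>E {0, 1} \<and> k - 1 = (\<Sum>i=1..d. b i * 2 ^ (i - 1))"
proof -
  have "\<exists>!b::nat \<Rightarrow> nat. b \<in> {1..d} \<rightarrow>\<^sub>E {0, 1} \<and> n = (\<Sum>i=1..d. b i * 2 ^ (i - 1))"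
    if "n < 2 ^ d" for n :: nat
    using that
  proof (induction d arbitrary: n)
    case 0
    then show ?case by (auto simp: PiE_empty_domain)
  next
    case (Suc d)
    have split: "(\<Sum>i=1..Suc d. b i * 2 ^ (i - 1)) = (\<Sum>i=1..d. b i * 2 ^ (i - 1)) + b (Suc d) * 2 ^ d"
      for b :: "nat \<Rightarrow> nat" by simp
    have bound: "(\<Sum>i=1..d. b i * 2 ^ (i - 1)) < 2 ^ d"
      if "\<And>i. i \<in> {1..d} \<Longrightarrow> b i \<in> {0, 1}" for b :: "nat \<Rightarrow> nat"
      using that
    proof (induction d)
      case (Suc d)
      have "(\<Sum>i=1..d. b i * 2 ^ (i - 1)) < 2 ^ d" by (rule Suc.IH) (use Suc.prems in auto)
      moreover have "b (Suc d) \<le> 1" using Suc.prems[of "Suc d"] by auto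
      then have "b (Suc d) * 2 ^ d \<le> 1 * 2 ^ d" by (rule mult_le_mono1)
      moreover have "(\<Sum>i=1..Suc d. b i * 2 ^ (i - 1)) = (\<Sum>i=1..d. b i * 2 ^ (i - 1)) + b (Suc d) * 2 ^ d"
        by simp
      ultimately show ?case unfolding power_Suc by linarith
    qed auto
    define q where "q = n div 2 ^ d"
    define r where "r = n mod 2 ^ d"
    have q: "q \<in> {0, 1}"
    proof -
      have "q < 2" using Suc.prems unfolding q_def by (simp add: less_mult_imp_div_less)
      then show ?thesis by auto
    qed
    have r: "r < 2 ^ d" by (simp add: r_def)
    have n: "n = r + q * 2 ^ d" unfolding q_def r_def by (rule mod_div_mult_eq[symmetric])
    from Suc.IH[OF r] obtain c :: "nat \<Rightarrow> nat" where
      c: "c \<in> {1..d} \<rightarrow>\<^sub>E {0, 1}" "r = (\<Sum>i=1..d. c i * 2 ^ (i - 1))" and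
      uniq: "\<And>c'. c' \<in> {1..d} \<rightarrow>\<^sub>E {0, 1} \<Longrightarrow> r = (\<Sum>i=1..d. c' i * 2 ^ (i - 1)) \<Longrightarrow> c' = c"
      by (elim ex1E conjE) blast
    show ?case
    proof (rule ex1I[of _ "c(Suc d := q)"])
      have "(\<Sum>i=1..d. (c(Suc d := q)) i * 2 ^ (i - 1)) = r"
        unfolding c(2) by (intro sum.cong) auto
      moreover have "c(Suc d := q) \<in> {1..Suc d} \<rightarrow>\<^sub>E {0, 1}"
        using c(1) q by (auto simp: PiE_iff extensional_def le_Suc_eq)
      ultimately show "c(Suc d := q) \<in> {1..Suc d} \<rightarrow>\<^sub>E {0, 1} \<and>
          n = (\<Sum>i=1..Suc d. (c(Suc d := q)) i * 2 ^ (i - 1))"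
        unfolding split n by simp
    next
      fix b :: "nat \<Rightarrow> nat"
      assume b: "b \<in> {1..Suc d} \<rightarrow>\<^sub>E {0, 1} \<and> n = (\<Sum>i=1..Suc d. b i * 2 ^ (i - 1))"
      let ?s = "\<Sum>i=1..d. b i * 2 ^ (i - 1)"
      have s: "?s < 2 ^ d" by (rule bound) (use b in \<open>auto simp: PiE_iff\<close>)
      have nb: "n = ?s + b (Suc d) * 2 ^ d" using b unfolding split by blast
      have rs: "r = ?s" unfolding r_def nb using s by simp
      have qb: "q = b (Suc d)" unfolding q_def nb using s by simp
      have "b(Suc d := undefined) = c"
      proof (rule uniq)
        show "b(Suc d := undefined) \<in> {1..d} \<rightarrow>\<^sub>E {0, 1}"
          using b by (auto simp: PiE_iff extensional_def)
        show "r = (\<Sum>i=1..d. (b(Suc d := undefined)) i * 2 ^ (i - 1))"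
          unfolding rs by (intro sum.cong) auto
      qed
      then show "b = c(Suc d := q)" using qb by auto
    qed
  qed
  moreover have "k - 1 < 2 ^ d" using assms by auto
  ultimately show ?thesis by blast
qed

definition k_ge :: "nat \<Rightarrow> nat \<Rightarrow> (nat \<Rightarrow> int) \<Rightarrow> (nat \<Rightarrow> int) \<Rightarrow> bool" where
  "k_ge d k x y \<longleftrightarrow> (\<forall>i\<in>{1..d}. (-1) ^ kbits d k i * x i \<ge> (-1) ^ kbits d k i * y i)"

definition k_type_mixing ::
    "nat \<Rightarrow> nat \<Rightarrow> 'a topology \<Rightarrow> ((nat \<Rightarrow> int) \<Rightarrow> 'a \<Rightarrow> 'a) \<Rightarrow> bool" where
  "k_type_mixing d k X T \<longleftrightarrow>
     (\<forall>U V. openin X U \<and> openin X V \<and> U \<noteq> {} \<and> V \<noteq> {} \<longrightarrow>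
       (\<exists>F. finite F \<and> F \<subseteq> {n \<in> zd d. k_ge d k n (\<lambda>i. 0)} \<and>
         (\<forall>m\<in>zd d. k_ge d k m (\<lambda>i. 0) \<and> m \<notin> F \<longrightarrow> T m ` U \<inter> V \<noteq> {})))"

definition Sub :: "'a set \<Rightarrow> ('a \<Rightarrow> 'a \<Rightarrow> real) \<Rightarrow> 'a set set" where
  "Sub X \<rho> = {A. A \<noteq> {} \<and> closedin (Metric_space.mtopology X \<rho>) A}"

definition point_set_dist :: "('a \<Rightarrow> 'a \<Rightarrow> real) \<Rightarrow> 'a \<Rightarrow> 'a set \<Rightarrow> real" where
  "point_set_dist \<rho> x S = (INF s\<in>S. \<rho> x s)"

text \<open>The locale \<^locale>\<open>Metric_space\<close> demands nonnegativity also outside the carrier, hence the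
  dummy value \<open>0\<close> there.\<close>

definition hausdorff_metric ::
    "'a set \<Rightarrow> ('a \<Rightarrow> 'a \<Rightarrow> real) \<Rightarrow> 'a set \<Rightarrow> 'a set \<Rightarrow> real" where
  "hausdorff_metric X \<rho> A B =
     (if A \<in> Sub X \<rho> \<and> B \<in> Sub X \<rho>
      then max (SUP a\<in>A. point_set_dist \<rho> a B) (SUP b\<in>B. point_set_dist \<rho> b A)
      else 0)"

lemma Metric_space_hausdorff:
  assumes "Metric_space X \<rho>" and comp: "compact_space (Metric_space.mtopology X \<rho>)"
  shows "Metric_space (Sub X \<rho>) (hausdorff_metric X \<rho>)"
proof -
  interpret Metric_space X \<rho> by fact
  let ?S = "Sub X \<rho>" and ?d = "point_set_dist \<rho>" and ?H = "hausdorff_metric X \<rho>"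
  have sub: "A \<subseteq> X" "A \<noteq> {}" if "A \<in> ?S" for A
    using that closedin_subset[of mtopology A] by (auto simp: Sub_def)
  have "mbounded X"
    using comp by (simp add: compact_space_def compactin_imp_mbounded)
  then obtain D where D: "\<And>x y. x \<in> X \<Longrightarrow> y \<in> X \<Longrightarrow> \<rho> x y \<le> D"
    unfolding mbounded_alt by blast
  have bdb: "bdd_below (\<rho> x ` A)" for x A
    by (rule bdd_belowI[of _ 0]) auto
  have d_le: "?d x A \<le> \<rho> x a" if "a \<in> A" for x a A
    unfolding point_set_dist_def using that bdb by (rule cINF_lower[rotated])
  have d_ge: "e \<le> ?d x A" if "A \<in> ?S" "\<And>a. a \<in> A \<Longrightarrow> e \<le> \<rho> x a" for x A e
    unfolding point_set_dist_def using sub(2)[OF that(1)] that(2) by (rule cINF_greatest)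
  have d_nonneg: "0 \<le> ?d x A" if "A \<in> ?S" for x A
    using that by (rule d_ge) auto
  have d_D: "?d x A \<le> D" if x: "x \<in> X" and A: "A \<in> ?S" for x A
  proof -
    obtain a where a: "a \<in> A" using sub(2)[OF A] by blast
    then have "\<rho> x a \<le> D" using D x sub(1)[OF A] by blast
    then show ?thesis using d_le[OF a, of x] by linarith
  qed
  have bda: "bdd_above ((\<lambda>a. ?d a B) ` A)" if "A \<in> ?S" "B \<in> ?S" for A B
  proof (rule bdd_aboveI2)
    show "?d a B \<le> D" if "a \<in> A" for a
      using d_D[OF _ \<open>B \<in> ?S\<close>] sub(1)[OF \<open>A \<in> ?S\<close>] that by blast
  qed
  have H_comm: "?H A B = ?H B A" for A B
    by (simp add: hausdorff_metric_def max.commute)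
  have d_H: "?d a B \<le> ?H A B" if "A \<in> ?S" "B \<in> ?S" "a \<in> A" for A B a
  proof -
    have "?d a B \<le> (SUP a\<in>A. ?d a B)" by (rule cSUP_upper[OF that(3) bda[OF that(1,2)]])
    then show ?thesis using that by (simp add: hausdorff_metric_def)
  qed
  have H_le: "?H A B \<le> e"
    if "A \<in> ?S" "B \<in> ?S" "\<And>a. a \<in> A \<Longrightarrow> ?d a B \<le> e" "\<And>b. b \<in> B \<Longrightarrow> ?d b A \<le> e" for A B e
  proof -
    have "(SUP a\<in>A. ?d a B) \<le> e" using sub(2)[OF that(1)] that(3) by (rule cSUP_least)
    moreover have "(SUP b\<in>B. ?d b A) \<le> e" using sub(2)[OF that(2)] that(4) by (rule cSUP_least)
    ultimately show ?thesis using that(1,2) by (simp add: hausdorff_metric_def)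
  qed
  have H_nonneg: "0 \<le> ?H A B" for A B
  proof (cases "A \<in> ?S \<and> B \<in> ?S")
    case True
    then obtain a where "a \<in> A" using sub(2)[of A] by blast
    then show ?thesis using d_H[of A B a] d_nonneg[of B a] True by linarith
  next
    case False
    then have "?H A B = 0" unfolding hausdorff_metric_def by (rule if_not_P)
    then show ?thesis by simp
  qed
  have H_self: "?H A A = 0" if "A \<in> ?S" for A
  proof -
    have "?d a A \<le> 0" if a: "a \<in> A" for a
    proof -
      have "\<rho> a a = 0" using a sub(1)[OF \<open>A \<in> ?S\<close>] by (intro mdist_zero) blast
      then show ?thesis using d_le[OF a, of a] by linarith
    qed
    then have "?H A A \<le> 0" using that by (intro H_le) auto
    then show ?thesis using H_nonneg[of A A] by linarith
  qed
  have d_less: "\<exists>a\<in>A. \<rho> x a < e" if "A \<in> ?S" "?d x A < e" for A x e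
    using that d_ge[of A e x] by (meson not_le)
  have incl: "A \<subseteq> B" if AB: "A \<in> ?S" "B \<in> ?S" and "?H A B = 0" for A B
  proof
    fix a assume a: "a \<in> A"
    have aX: "a \<in> X" using a sub(1)[OF AB(1)] by blast
    have "\<exists>y\<in>B. y \<in> mball a r" if "r > 0" for r
    proof -
      have "?d a B < r" using d_H[OF AB a] \<open>?H A B = 0\<close> that by linarith
      then obtain b where "b \<in> B" "\<rho> a b < r" using d_less[OF AB(2)] by blast
      then show ?thesis using aX sub(1)[OF AB(2)] by auto
    qed
    then have "a \<in> mtopology closure_of B"
      unfolding metric_closure_of using aX by blast
    moreover have "mtopology closure_of B = B" using AB by (simp add: Sub_def closure_of_closedin)
    ultimately show "a \<in> B" by simp
  qed
  have d_tri: "?d a C \<le> ?H A B + ?H B C"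
    if S: "A \<in> ?S" "B \<in> ?S" "C \<in> ?S" and a: "a \<in> A" for A B C a
  proof (rule field_le_epsilon)
    fix e :: real assume e: "e > 0"
    have "?d a B < ?H A B + e / 2" using d_H[of A B a] S a e by linarith
    then obtain b where b: "b \<in> B" "\<rho> a b < ?H A B + e / 2" using d_less[OF S(2)] by blast
    have "?d b C < ?H B C + e / 2" using d_H[of B C b] S b e by linarith
    then obtain c where c: "c \<in> C" "\<rho> b c < ?H B C + e / 2" using d_less[OF S(3)] by blast
    have "\<rho> a c \<le> \<rho> a b + \<rho> b c"
      using a b(1) c(1) sub(1)[OF S(1)] sub(1)[OF S(2)] sub(1)[OF S(3)] by (intro triangle) blast+
    then show "?d a C \<le> ?H A B + ?H B C + e" using d_le[OF c(1), of a] b c by linarith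
  qed
  show ?thesis
  proof
    show "0 \<le> ?H A B" for A B by (rule H_nonneg)
    show "?H A B = ?H B A" for A B by (rule H_comm)
    show "?H A B = 0 \<longleftrightarrow> A = B" if S: "A \<in> ?S" "B \<in> ?S" for A B
    proof
      assume 0: "?H A B = 0"
      then have "?H B A = 0" using H_comm[of B A] by (rule trans[rotated])
      then show "A = B" using incl[OF S 0] incl[OF S(2,1)] by blast
    next
      assume "A = B"
      then show "?H A B = 0" using H_self S by blast
    qed
    show "?H A C \<le> ?H A B + ?H B C" if S: "A \<in> ?S" "B \<in> ?S" "C \<in> ?S" for A B C
    proof (rule H_le[OF S(1,3)])
      show "?d a C \<le> ?H A B + ?H B C" if "a \<in> A" for a
        using d_tri[OF S that] .
      show "?d c A \<le> ?H A B + ?H B C" if "c \<in> C" for c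
        using d_tri[OF S(3,2,1) that] H_comm[of A B] H_comm[of B C] by linarith
    qed
  qed
qed

definition induced_action :: "((nat \<Rightarrow> int) \<Rightarrow> 'a \<Rightarrow> 'a) \<Rightarrow> (nat \<Rightarrow> int) \<Rightarrow> 'a set \<Rightarrow> 'a set" where
  "induced_action T m A = T m ` A"

end

theory Submission
  imports Defs
begin

text \<open>Mixing need only be tested on pairs of balls of a common radius, in \<open>X\<close> as well as in the
  hyperspace (\<open>k_type_mixing_iff_mballs\<close>).

  If the hyperspace is mixing, compare the Hausdorff balls around the singletons \<open>{x}\<close> and \<open>{y}\<close>:
  a closed set within \<open>r\<close> of \<open>{x}\<close> lies in the \<open>r\<close>-ball around \<open>x\<close>, so each of its points is a
  witness for mixing of \<open>X\<close> as soon as its image is within \<open>r\<close> of \<open>{y}\<close>.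

  Conversely, let \<open>A\<close> and \<open>B\<close> be closed. By compactness they have finite nets \<open>K \<subseteq> A\<close> and
  \<open>L \<subseteq> B\<close> for a radius \<open>s\<close>. Mixing of \<open>X\<close>, applied to the finitely many pairs
  \<open>(a, b) \<in> K \<times> L\<close>, shows that for all but finitely many \<open>m\<close> in the orthant every pair has a
  point \<open>f a b\<close> near \<open>a\<close> that \<open>T m\<close> sends near \<open>b\<close>. The finite set of all these points is close
  to \<open>A\<close>, because its points shadow every \<open>a \<in> K\<close>, and its image is close to \<open>B\<close>, because it
  shadows every \<open>b \<in> L\<close>. Finite sets are closed, so this is a point of the hyperspace.\<close>

lemma k_type_mixing_iff_mballs:
  assumes "Metric_space M \<delta>"
  shows "k_type_mixing d k (Metric_space.mtopology M \<delta>) T \<longleftrightarrow>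
    (\<forall>x\<in>M. \<forall>y\<in>M. \<forall>r>0. \<exists>F. finite F \<and> F \<subseteq> {n \<in> zd d. k_ge d k n (\<lambda>i. 0)} \<and>
      (\<forall>m\<in>zd d. k_ge d k m (\<lambda>i. 0) \<and> m \<notin> F \<longrightarrow>
        T m ` Metric_space.mball M \<delta> x r \<inter> Metric_space.mball M \<delta> y r \<noteq> {}))"
    (is "_ \<longleftrightarrow> ?balls")
proof -
  interpret Metric_space M \<delta> by fact
  show ?thesis
  proof
    assume "k_type_mixing d k mtopology T"
    then have mixing: "\<exists>F. finite F \<and> F \<subseteq> {n \<in> zd d. k_ge d k n (\<lambda>i. 0)} \<and>
        (\<forall>m\<in>zd d. k_ge d k m (\<lambda>i. 0) \<and> m \<notin> F \<longrightarrow> T m ` U \<inter> V \<noteq> {})"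
      if "openin mtopology U" "openin mtopology V" "U \<noteq> {}" "V \<noteq> {}" for U V
      using that unfolding k_type_mixing_def by blast
    show ?balls
    proof (intro ballI allI impI)
      fix x y and r :: real assume "x \<in> M" "y \<in> M" "r > 0"
      then have "x \<in> mball x r" "y \<in> mball y r" by auto
      then show "\<exists>F. finite F \<and> F \<subseteq> {n \<in> zd d. k_ge d k n (\<lambda>i. 0)} \<and>
          (\<forall>m\<in>zd d. k_ge d k m (\<lambda>i. 0) \<and> m \<notin> F \<longrightarrow> T m ` mball x r \<inter> mball y r \<noteq> {})"
        by (intro mixing openin_mball) blast+
    qed
  next
    assume balls: ?balls
    show "k_type_mixing d k mtopology T"
      unfolding k_type_mixing_def
    proof (intro allI impI, elim conjE)
      fix U V assume U: "openin mtopology U" "U \<noteq> {}" and V: "openin mtopology V" "V \<noteq> {}"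
      from U obtain x r where x: "x \<in> M" "r > 0" "mball x r \<subseteq> U"
        unfolding openin_mtopology by blast
      from V obtain y s where y: "y \<in> M" "s > 0" "mball y s \<subseteq> V"
        unfolding openin_mtopology by blast
      have sub: "mball x (min r s) \<subseteq> U" "mball y (min r s) \<subseteq> V"
        using x(3) y(3) mball_subset_concentric[of "min r s" r x]
          mball_subset_concentric[of "min r s" s y] by auto
      have "min r s > 0" using x(2) y(2) by simp
      with balls x(1) y(1) obtain F where
        F: "finite F" "F \<subseteq> {n \<in> zd d. k_ge d k n (\<lambda>i. 0)}" and
        meet: "\<forall>m\<in>zd d. k_ge d k m (\<lambda>i. 0) \<and> m \<notin> F \<longrightarrow>
          T m ` mball x (min r s) \<inter> mball y (min r s) \<noteq> {}"
        by meson
      have "T m ` U \<inter> V \<noteq> {}" if "T m ` mball x (min r s) \<inter> mball y (min r s) \<noteq> {}" for m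
        using that sub by blast
      with meet have "\<forall>m\<in>zd d. k_ge d k m (\<lambda>i. 0) \<and> m \<notin> F \<longrightarrow> T m ` U \<inter> V \<noteq> {}"
        by simp
      with F show "\<exists>F. finite F \<and> F \<subseteq> {n \<in> zd d. k_ge d k n (\<lambda>i. 0)} \<and>
          (\<forall>m\<in>zd d. k_ge d k m (\<lambda>i. 0) \<and> m \<notin> F \<longrightarrow> T m ` U \<inter> V \<noteq> {})"
        by (intro exI[of _ F] conjI)
    qed
  qed
qed

lemma zd_action_maps_to:
  assumes "zd_action d X T" "m \<in> zd d" "x \<in> topspace X"
  shows "T m x \<in> topspace X"
proof -
  have "(\<lambda>(n, x). T n x) \<in> topspace (prod_topology (discrete_topology (zd d)) X) \<rightarrow> topspace X"
    using assms(1) unfolding zd_action_def by (blast dest: continuous_map_funspace)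
  then show ?thesis using assms(2,3) by (auto simp: Pi_iff)
qed

context Metric_space
begin

lemma Sub_subset: "A \<in> Sub M d \<Longrightarrow> A \<subseteq> M"
  unfolding Sub_def using closedin_subset by force

lemma finite_in_Sub:
  assumes "finite A" "A \<noteq> {}" "A \<subseteq> M"
  shows "A \<in> Sub M d"
  using assms t1_space_mtopology by (simp add: Sub_def t1_space_closedin_finite)

lemma point_set_dist_le: "b \<in> B \<Longrightarrow> point_set_dist d a B \<le> d a b"
  unfolding point_set_dist_def by (intro cINF_lower bdd_belowI[of _ 0]) auto

text \<open>Compactness enters through boundedness: without it the suprema in the Hausdorff metric
  could be taken over unbounded sets of reals, and a small value would carry no information.\<close>

lemma hausdorff_metric_less_imp_near:
  assumes comp: "compact_space mtopology"
    and AB: "A \<in> Sub M d" "B \<in> Sub M d"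
    and less: "hausdorff_metric M d A B < e"
  shows "a \<in> A \<Longrightarrow> \<exists>b\<in>B. d a b < e"
    and "b \<in> B \<Longrightarrow> \<exists>a\<in>A. d a b < e"
proof -
  have "mbounded M"
    using comp by (simp add: compact_space_def compactin_imp_mbounded)
  then obtain D where D: "\<And>x y. x \<in> M \<Longrightarrow> y \<in> M \<Longrightarrow> d x y \<le> D"
    unfolding mbounded_alt by blast
  have near: "\<exists>b\<in>B. d a b < e"
    if S: "A \<in> Sub M d" "B \<in> Sub M d" "a \<in> A" and "(SUP a\<in>A. point_set_dist d a B) < e"
    for A B a
  proof -
    have B: "B \<noteq> {}" using S(2) by (simp add: Sub_def)
    then obtain b0 where "b0 \<in> B" by blast
    then have "point_set_dist d x B \<le> D" if "x \<in> A" for x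
      using point_set_dist_le[of b0 B x] D[of x b0] that Sub_subset[OF S(1)] Sub_subset[OF S(2)]
      by fastforce
    then have "point_set_dist d a B \<le> (SUP a\<in>A. point_set_dist d a B)"
      by (intro cSUP_upper[OF S(3)] bdd_aboveI2)
    then have "point_set_dist d a B < e" using that(4) by linarith
    then show ?thesis
      unfolding point_set_dist_def using B cINF_greatest[of B e "d a"] by (meson not_le)
  qed
  have less': "(SUP a\<in>A. point_set_dist d a B) < e" "(SUP b\<in>B. point_set_dist d b A) < e"
    using less AB by (auto simp: hausdorff_metric_def)
  show "a \<in> A \<Longrightarrow> \<exists>b\<in>B. d a b < e" by (rule near[OF AB _ less'(1)])
  show "b \<in> B \<Longrightarrow> \<exists>a\<in>A. d a b < e" using near[OF AB(2,1) _ less'(2)] by (subst commute)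
qed

lemma hausdorff_metric_le:
  assumes AB: "A \<in> Sub M d" "B \<in> Sub M d"
    and "\<And>a. a \<in> A \<Longrightarrow> \<exists>b\<in>B. d a b \<le> e"
    and "\<And>b. b \<in> B \<Longrightarrow> \<exists>a\<in>A. d a b \<le> e"
  shows "hausdorff_metric M d A B \<le> e"
proof -
  have ne: "A \<noteq> {}" "B \<noteq> {}" using AB by (auto simp: Sub_def)
  have "point_set_dist d a B \<le> e" if "a \<in> A" for a
    using assms(3)[OF that] point_set_dist_le[of _ B a] by fastforce
  moreover have "point_set_dist d b A \<le> e" if "b \<in> B" for b
    using assms(4)[OF that] point_set_dist_le[of _ A b] by (fastforce simp: commute)
  ultimately show ?thesis
    using AB ne by (auto simp: hausdorff_metric_def intro: cSUP_least)
qed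

text \<open>A set that shadows a finite net of \<open>A\<close> at scale \<open>s\<close> is \<open>2s\<close>-close to \<open>A\<close>: every point of
  \<open>A\<close> is within \<open>s\<close> of the net, and the net within \<open>s\<close> of the set.\<close>

lemma hausdorff_metric_le_shadow_net:
  assumes A: "A \<in> Sub M d" and C: "C \<in> Sub M d"
    and K: "K \<subseteq> A" "A \<subseteq> (\<Union>a\<in>K. mball a s)"
    and "\<And>a. a \<in> K \<Longrightarrow> \<exists>c\<in>C. d a c < s"
    and "\<And>c. c \<in> C \<Longrightarrow> \<exists>a\<in>K. d a c < s"
  shows "hausdorff_metric M d A C \<le> 2 * s"
proof (rule hausdorff_metric_le[OF A C])
  fix x assume x: "x \<in> A"
  then obtain a where a: "a \<in> K" "d a x < s" "a \<in> M" "x \<in> M" using K(2) by auto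
  obtain c where c: "c \<in> C" "d a c < s" using assms(5) a(1) by blast
  have "d x c \<le> d a x + d a c"
    using triangle[of x a c] commute[of x a] a c Sub_subset[OF C] by auto
  then show "\<exists>c\<in>C. d x c \<le> 2 * s" using a c by (intro bexI[of _ c]) auto
next
  fix c assume "c \<in> C"
  then obtain a where a: "a \<in> K" "d a c < s" using assms(6) by blast
  then have "d a c \<le> 2 * s" using nonneg[of a c] by linarith
  then show "\<exists>x\<in>A. d x c \<le> 2 * s" using a K(1) by blast
qed

lemma Sub_finite_net:
  assumes "compact_space mtopology" "A \<in> Sub M d" "s > 0"
  obtains K where "finite K" "K \<noteq> {}" "K \<subseteq> A" "A \<subseteq> (\<Union>a\<in>K. mball a s)"
proof -
  have "compactin mtopology A"
    using assms(1,2) by (simp add: Sub_def closedin_compact_space)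
  then have "mtotally_bounded A" by (rule compactin_imp_mtotally_bounded)
  then obtain K where K: "finite K" "K \<subseteq> A" "A \<subseteq> (\<Union>a\<in>K. mball a s)"
    using assms(3) unfolding mtotally_bounded_def by meson
  have "K \<noteq> {}" using K(3) assms(2) by (auto simp: Sub_def)
  from that[OF K(1) this K(2,3)] show ?thesis .
qed

end

theorem theorem3p5:
  fixes X :: "'a set" and \<rho> :: "'a \<Rightarrow> 'a \<Rightarrow> real"
    and d k :: nat and T :: "(nat \<Rightarrow> int) \<Rightarrow> 'a \<Rightarrow> 'a"
  assumes "Metric_space X \<rho>"
    and "compact_space (Metric_space.mtopology X \<rho>)"
    and "d \<ge> 1"
    and "zd_action d (Metric_space.mtopology X \<rho>) T"
    and "k \<in> {1..2 ^ d}"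
  shows "k_type_mixing d k (Metric_space.mtopology X \<rho>) T \<longleftrightarrow>
    k_type_mixing d k (Metric_space.mtopology (Sub X \<rho>) (hausdorff_metric X \<rho>)) (induced_action T)"
proof -
  interpret Metric_space X \<rho> by fact
  let ?H = "hausdorff_metric X \<rho>" and ?P = "{n \<in> zd d. k_ge d k n (\<lambda>i. 0)}"
  interpret H: Metric_space "Sub X \<rho>" ?H by (rule Metric_space_hausdorff) fact+
  have T_in: "T m x \<in> X" if "m \<in> zd d" "x \<in> X" for m x
    using zd_action_maps_to[OF assms(4)] that by simp
  show ?thesis
    unfolding k_type_mixing_iff_mballs[OF assms(1)] k_type_mixing_iff_mballs[OF H.Metric_space_axioms]
  proof (intro iffI ballI allI impI)
    fix A B and r :: real
    assume mixing: "\<forall>x\<in>X. \<forall>y\<in>X. \<forall>r>0. \<exists>F. finite F \<and> F \<subseteq> ?P \<and>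
        (\<forall>m\<in>zd d. k_ge d k m (\<lambda>i. 0) \<and> m \<notin> F \<longrightarrow> T m ` mball x r \<inter> mball y r \<noteq> {})"
      and A: "A \<in> Sub X \<rho>" and B: "B \<in> Sub X \<rho>" and r: "r > 0"
    (* Shadowing a net at scale s gives Hausdorff distance at most 2 s, which must be below r. *)
    define s where "s = r / 3"
    have s: "s > 0" "2 * s < r" using r by (auto simp: s_def)
    obtain K where K: "finite K" "K \<noteq> {}" "K \<subseteq> A" "A \<subseteq> (\<Union>a\<in>K. mball a s)"
      by (rule Sub_finite_net[OF assms(2) A s(1)])
    obtain L where L: "finite L" "L \<noteq> {}" "L \<subseteq> B" "B \<subseteq> (\<Union>b\<in>L. mball b s)"
      by (rule Sub_finite_net[OF assms(2) B s(1)])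
    define Q where "Q a b F \<longleftrightarrow> finite F \<and> F \<subseteq> ?P \<and>
        (\<forall>m\<in>zd d. k_ge d k m (\<lambda>i. 0) \<and> m \<notin> F \<longrightarrow> T m ` mball a s \<inter> mball b s \<noteq> {})" for a b F
    have "\<forall>a\<in>K. \<forall>b\<in>L. \<exists>F. Q a b F"
      unfolding Q_def using mixing s(1) K(3) L(3) Sub_subset[OF A] Sub_subset[OF B] by (meson subsetD)
    then obtain F where F: "\<And>a b. a \<in> K \<Longrightarrow> b \<in> L \<Longrightarrow> Q a b (F a b)"
      by metis
    show "\<exists>F. finite F \<and> F \<subseteq> ?P \<and> (\<forall>m\<in>zd d. k_ge d k m (\<lambda>i. 0) \<and> m \<notin> F \<longrightarrow>
        induced_action T m ` H.mball A r \<inter> H.mball B r \<noteq> {})"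
    proof (intro exI[of _ "\<Union>a\<in>K. \<Union>b\<in>L. F a b"] conjI ballI impI)
      show "finite (\<Union>a\<in>K. \<Union>b\<in>L. F a b)" using K(1) L(1) F by (simp add: Q_def)
      show "(\<Union>a\<in>K. \<Union>b\<in>L. F a b) \<subseteq> ?P" using F unfolding Q_def by blast
      fix m assume m: "m \<in> zd d" "k_ge d k m (\<lambda>i. 0) \<and> m \<notin> (\<Union>a\<in>K. \<Union>b\<in>L. F a b)"
      have "\<exists>x. x \<in> mball a s \<and> T m x \<in> mball b s" if "a \<in> K" "b \<in> L" for a b
      proof -
        have "T m ` mball a s \<inter> mball b s \<noteq> {}" using F[OF that] m that unfolding Q_def by blast
        then show ?thesis by blast
      qed
      then obtain f where f: "\<And>a b. a \<in> K \<Longrightarrow> b \<in> L \<Longrightarrow> f a b \<in> mball a s \<and> T m (f a b) \<in> mball b s"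
        by metis
      define C where "C = (\<lambda>(a, b). f a b) ` (K \<times> L)"
      have C_fin: "finite C" "C \<noteq> {}" using K(1,2) L(1,2) by (auto simp: C_def)
      have C_X: "C \<subseteq> X" using f by (force simp: C_def)
      have C: "C \<in> Sub X \<rho>" using C_fin C_X by (rule finite_in_Sub)
      have TC: "T m ` C \<in> Sub X \<rho>" using C_fin C_X T_in m(1) by (intro finite_in_Sub) auto
      have "?H A C \<le> 2 * s"
      proof (rule hausdorff_metric_le_shadow_net[OF A C K(3,4)])
        fix a assume a: "a \<in> K"
        obtain b where "b \<in> L" using L(2) by blast
        with a f[OF a this] show "\<exists>c\<in>C. \<rho> a c < s" by (force simp: C_def)
      next
        fix c assume "c \<in> C"
        then show "\<exists>a\<in>K. \<rho> a c < s" using f by (force simp: C_def)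
      qed
      moreover have "?H B (T m ` C) \<le> 2 * s"
      proof (rule hausdorff_metric_le_shadow_net[OF B TC L(3,4)])
        fix b assume b: "b \<in> L"
        obtain a where "a \<in> K" using K(2) by blast
        with b f[OF this b] show "\<exists>c\<in>T m ` C. \<rho> b c < s" by (force simp: C_def)
      next
        fix c assume "c \<in> T m ` C"
        then show "\<exists>b\<in>L. \<rho> b c < s" using f by (force simp: C_def)
      qed
      ultimately have "C \<in> H.mball A r" "induced_action T m C \<in> H.mball B r"
        using A B C TC s(2) by (auto simp: induced_action_def)
      then show "induced_action T m ` H.mball A r \<inter> H.mball B r \<noteq> {}" by blast
    qed
  next
    fix x y and r :: real
    assume mixing: "\<forall>A\<in>Sub X \<rho>. \<forall>B\<in>Sub X \<rho>. \<forall>r>0. \<exists>F. finite F \<and> F \<subseteq> ?P \<and>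
        (\<forall>m\<in>zd d. k_ge d k m (\<lambda>i. 0) \<and> m \<notin> F \<longrightarrow>
          induced_action T m ` H.mball A r \<inter> H.mball B r \<noteq> {})"
      and x: "x \<in> X" and y: "y \<in> X" and r: "r > 0"
    have near_singleton: "C \<subseteq> mball z r" if "z \<in> X" "C \<in> H.mball {z} r" for z C
    proof
      fix c assume c: "c \<in> C"
      have C: "C \<in> Sub X \<rho>" "?H {z} C < r" "{z} \<in> Sub X \<rho>" using that(2) by auto
      show "c \<in> mball z r"
        using hausdorff_metric_less_imp_near(2)[OF assms(2) C(3,1,2) c] that(1) c Sub_subset[OF C(1)]
        by auto
    qed
    have "{x} \<in> Sub X \<rho>" "{y} \<in> Sub X \<rho>" using x y by (auto intro: finite_in_Sub)
    with mixing r obtain F where F: "finite F" "F \<subseteq> ?P" and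
      meet: "\<forall>m\<in>zd d. k_ge d k m (\<lambda>i. 0) \<and> m \<notin> F \<longrightarrow>
        induced_action T m ` H.mball {x} r \<inter> H.mball {y} r \<noteq> {}"
      by meson
    have "T m ` mball x r \<inter> mball y r \<noteq> {}"
      if "induced_action T m ` H.mball {x} r \<inter> H.mball {y} r \<noteq> {}" for m
    proof -
      from that obtain C where C: "C \<in> H.mball {x} r" "T m ` C \<in> H.mball {y} r"
        unfolding induced_action_def by blast
      then have "C \<in> Sub X \<rho>" by auto
      then have "C \<noteq> {}" by (simp add: Sub_def)
      then show ?thesis using near_singleton[OF x C(1)] near_singleton[OF y C(2)] by blast
    qed
    with meet have "\<forall>m\<in>zd d. k_ge d k m (\<lambda>i. 0) \<and> m \<notin> F \<longrightarrow> T m ` mball x r \<inter> mball y r \<noteq> {}"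
      by simp
    with F show "\<exists>F. finite F \<and> F \<subseteq> ?P \<and>
        (\<forall>m\<in>zd d. k_ge d k m (\<lambda>i. 0) \<and> m \<notin> F \<longrightarrow> T m ` mball x r \<inter> mball y r \<noteq> {})"
      by (intro exI[of _ F] conjI)
  qed
qed

end
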